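(* Let $(R,B,L)$ be a Hadamard system in $\mathbb{R}^d$ and assume further that $R^T=R$. Suppose there is $G\in \mathrm{GL}_d(\mathbb{R})$ such that $G=G^T$, $GR=RG$ and $G(B)=L$. Then $G\,\Gamma(B)=\Gamma(L)$, and $$\sigma_{\Gamma(B)}^{(L)}(t)=\sigma_{\Gamma(L)}^{(B)}(Gt)\quad\text{for all } t\in\mathbb{R}^d.$$
   Context: Hadamard system $(R,B,L)$ in $\mathbb{R}^d$: $R$ is a $d\times d$ matrix with integer entries which is expansive (all eigenvalues $\lambda$ satisfy $|\lambda|>1$); $B,L\subset\mathbb{R}^d$ are finite sets with $0\in B$, $0\in L$, $\#B=\#L=N$; $R^k b\cdot l\in\mathbb{Z}$ for all $b\in B$, $l\in L$ and all integers $k\ge 0$; and the $N\times N$ matrix $\frac{1}{\sqrt N}\left(e^{2\pi i R^{-1}b\cdot l}\right)_{b\in B,\,l\in L}$ is unitary. Measures: for $b\in B$ let $\tau_b(x)=R^{-1}(x+b)$, and for $l\in L$ let $\sigma_l(x)=(R^T)^{-1}(x+l)$, $x\in\mathbb{R}^d$. $\mu_B$ is the unique Borel probability measure on $\mathbb{R}^d$ with $\mu_B=\frac1N\sum_{b\in B}\mu_B\circ\tau_b^{-1}$, and $\mu_L$ is the unique Borel probability measure with $\mu_L=\frac1N\sum_{l\in L}\mu_L\circ\sigma_l^{-1}$. Discrete sets: $\Gamma(B)=\{\sum_{k=0}^n R^k b_k : b_k\in B,\ n\ge 0\}$ and $\Gamma(L)=\{\sum_{k=0}^n (R^T)^k l_k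 : l_k\in L,\ n\ge 0\}$. Spectral functions, for $t\in\mathbb{R}^d$: $\sigma_{\Gamma(L)}^{(B)}(t)=\sum_{\gamma\in\Gamma(L)}|\widehat{\mu_B}(t+\gamma)|^2$ and $\sigma_{\Gamma(B)}^{(L)}(t)=\sum_{\xi\in\Gamma(B)}|\widehat{\mu_L}(t+\xi)|^2$, where $\widehat{\mu}(t)=\int_{\mathbb{R}^d}e^{2\pi i t\cdot x}\,d\mu(x)$. *)

theory Defs
  imports "HOL-Probability.Probability"
begin

(* Eigenvalues are taken over the complex numbers, so a real matrix has all its eigenvalues here. *)
definition complex_eigenvalue :: "real^'n^'n \<Rightarrow> complex \<Rightarrow> bool" where
  "complex_eigenvalue A z \<longleftrightarrow>
     (\<exists>v::complex^'n. v \<noteq> 0 \<and> map_matrix complex_of_real A *v v = z *s v)"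

definition expansive :: "real^'n^'n \<Rightarrow> bool" where
  "expansive A \<longleftrightarrow> (\<forall>z. complex_eigenvalue A z \<longrightarrow> cmod z > 1)"

(* Unitarity of a matrix whose rows and columns are indexed by two finite sets: orthonormal rows
   (U U* = I) and orthonormal columns (U* U = I). *)
definition unitary_on :: "'a set \<Rightarrow> 'b set \<Rightarrow> ('a \<Rightarrow> 'b \<Rightarrow> complex) \<Rightarrow> bool" where
  "unitary_on I J U \<longleftrightarrow>
     (\<forall>i\<in>I. \<forall>i'\<in>I. (\<Sum>j\<in>J. U i j * cnj (U i' j)) = (if i = i' then 1 else 0)) \<and>
     (\<forall>j\<in>J. \<forall>j'\<in>J. (\<Sum>i\<in>I. cnj (U i j) * U i j') = (if j = j' then 1 else 0))"

definition hadamard_system ::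
    "real^'n^'n \<Rightarrow> (real^'n) set \<Rightarrow> (real^'n) set \<Rightarrow> bool" where
  "hadamard_system R B L \<longleftrightarrow>
     (\<forall>i j. R $ i $ j \<in> \<int>) \<and> expansive R \<and>
     finite B \<and> finite L \<and> 0 \<in> B \<and> 0 \<in> L \<and> card B = card L \<and>
     (\<forall>b\<in>B. \<forall>l\<in>L. \<forall>k::nat. (((*v) R ^^ k) b) \<bullet> l \<in> \<int>) \<and>
     unitary_on B L (\<lambda>b l. 1 / complex_of_real (sqrt (real (card B))) *
       exp (2 * complex_of_real pi * \<i> * complex_of_real ((matrix_inv R *v b) \<bullet> l)))"

(* The notions below take the matrix M as a parameter: the objects attached to B use M = R, and
   those attached to L use M = transpose R. *)

definition ifs_map :: "real^'n^'n \<Rightarrow> real^'n \<Rightarrow> real^'n \<Rightarrow> real^'n" where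
  "ifs_map M b x = matrix_inv M *v (x + b)"

definition is_invariant_measure ::
    "real^'n^'n \<Rightarrow> (real^'n) set \<Rightarrow> (real^'n) measure \<Rightarrow> bool" where
  "is_invariant_measure M B \<mu> \<longleftrightarrow>
     prob_space \<mu> \<and> sets \<mu> = sets borel \<and>
     (\<forall>A\<in>sets borel.
        measure \<mu> A = 1 / real (card B) * (\<Sum>b\<in>B. measure (distr \<mu> borel (ifs_map M b)) A))"

definition invariant_measure :: "real^'n^'n \<Rightarrow> (real^'n) set \<Rightarrow> (real^'n) measure" where
  "invariant_measure M B = (THE \<mu>. is_invariant_measure M B \<mu>)"

definition digit_set :: "real^'n^'n \<Rightarrow> (real^'n) set \<Rightarrow> (real^'n) set" where
  "digit_set M B = {\<Sum>k=0..n. ((*v) M ^^ k) (b k) | (n::nat) b. \<forall>k\<le>n. b k \<in> B}"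

definition fourier_transform :: "(real^'n) measure \<Rightarrow> real^'n \<Rightarrow> complex" where
  "fourier_transform \<mu> t =
     (LINT x|\<mu>. exp (2 * complex_of_real pi * \<i> * complex_of_real (t \<bullet> x)))"

(* The sum runs over the elements of \<Gamma>, each counted once, and is taken in [0, \<infinity>], where it
   always exists. *)
definition spectral_function ::
    "(real^'n) measure \<Rightarrow> (real^'n) set \<Rightarrow> real^'n \<Rightarrow> ennreal" where
  "spectral_function \<mu> \<Gamma> t =
     (\<Sum>\<^sub>\<infinity>\<gamma>\<in>\<Gamma>. ennreal ((cmod (fourier_transform \<mu> (t + \<gamma>)))\<^sup>2))"

end

theory Submission
  imports Defs
begin

text \<open>
  As \<open>R\<^sup>T = R\<close>, the objects attached to \<open>B\<close> and to \<open>L\<close> are built from the same matrix.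
  Since \<open>G\<close> commutes with \<open>R\<close>, applying \<open>G\<close> to a sum \<open>\<Sum>k. R\<^sup>k b\<^sub>k\<close> replaces each
  digit \<open>b\<^sub>k\<close> by \<open>G b\<^sub>k\<close>, so \<open>G\<close> maps \<open>\<Gamma>(B)\<close> bijectively onto \<open>\<Gamma>(L)\<close>
  (\<open>digit_set_image\<close>). It also intertwines the two iterated function systems,
  \<open>G \<circ> \<tau>\<^sub>b = \<sigma>\<^bsub>G b\<^esub> \<circ> G\<close>, so it pushes an invariant measure of \<open>(R, B)\<close> forward to
  one of \<open>(R, L)\<close> (\<open>is_invariant_measure_distr\<close>). By uniqueness \<open>\<mu>\<^sub>L\<close> is the image of
  \<open>\<mu>\<^sub>B\<close> under \<open>G\<close>, and as \<open>G\<close> is symmetric, the Fourier transform of \<open>\<mu>\<^sub>L\<close> at \<open>t\<close> is that of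
  \<open>\<mu>\<^sub>B\<close> at \<open>G t\<close> (\<open>fourier_transform_distr_matrix\<close>). Reindexing the sum over \<open>\<Gamma>(L)\<close> along
  \<open>G\<close> yields the identity of spectral functions.

  The substance is that the invariant measure exists and is unique
  (\<open>ex1_invariant_measure\<close>), which is shown whenever the inverse matrix shrinks the Euclidean norm
  by a factor \<open>r < 1\<close>. For existence, let \<open>b\<^sub>0, b\<^sub>1, \<dots>\<close> be independent and uniform in
  \<open>B\<close>: the law of the series \<open>\<Sum>k. R\<^bsup>-k-1\<^esup> b\<^sub>k\<close> is invariant, because prefixing a digit
  \<open>b\<close> acts on the value of the series as \<open>\<tau>\<^sub>b\<close>. For uniqueness, two invariant measures are put
  on a product space, and after \<open>n\<close> applications of the invariance equation the integrals of a
  Lipschitz function differ by at most the mean of \<open>min 1 (K \<parallel>R\<^bsup>-n\<^esup>(x - y)\<parallel>)\<close>, which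
  tends to 0 (\<open>invariant_integral_unique\<close>); such functions determine the measure
  (\<open>borel_prob_eqI_Lipschitz\<close>).

  That the inverse is a contraction in the Euclidean norm uses the symmetry of \<open>R\<close>: the minimum of
  \<open>\<parallel>R v\<parallel>\<close> over the unit sphere is the absolute value of a real eigenvalue
  (\<open>symmetric_matrix_bounded_below\<close>), so it exceeds 1 when \<open>R\<close> is expansive.
\<close>

section \<open>Symmetric expansive matrices\<close>

lemma symmetric_matrix_bounded_below:
  fixes R :: "real^'n^'n"
  assumes sym: "transpose R = R" and exp: "expansive R"
  obtains c where "c > 1" "\<And>v. c * norm v \<le> norm (R *v v)"
proof -
  have dot: "(R *v x) \<bullet> y = x \<bullet> (R *v y)" for x y
    by (metis dot_lmul_matrix sym vector_transpose_matrix)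
  \<comment> \<open>A real eigenvector is also a complex one, so expansiveness applies to real eigenvalues.\<close>
  have eig: "\<bar>l\<bar> > 1" if "v \<noteq> 0" "R *v v = l *\<^sub>R v" for l v
  proof -
    define w where "w = (\<chi> i. complex_of_real (v $ i))"
    have "w \<noteq> 0"
      using that(1) by (auto simp: w_def vec_eq_iff)
    moreover have "map_matrix complex_of_real R *v w = complex_of_real l *s w"
    proof -
      have "(\<Sum>j\<in>UNIV. complex_of_real (R $ i $ j) * complex_of_real (v $ j)) =
              complex_of_real l * complex_of_real (v $ i)" for i
      proof -
        have "(\<Sum>j\<in>UNIV. R $ i $ j * v $ j) = l * v $ i"
          using arg_cong[OF that(2), of "\<lambda>x. x $ i"] by (simp add: matrix_vector_mult_def)
        from arg_cong[OF this, of complex_of_real] show ?thesis by simp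
      qed
      then show ?thesis
        by (simp add: w_def vec_eq_iff matrix_vector_mult_def map_matrix_def)
    qed
    ultimately have "complex_eigenvalue R (complex_of_real l)"
      by (auto simp: complex_eigenvalue_def)
    then show ?thesis using exp by (auto simp: expansive_def)
  qed
  have "continuous_on (sphere 0 1) (\<lambda>v. norm (R *v v))"
    by (intro continuous_intros)
  moreover have "sphere (0::real^'n) 1 \<noteq> {}" by simp
  ultimately obtain v0 where v0: "v0 \<in> sphere 0 1"
    and min: "\<And>v. v \<in> sphere 0 1 \<Longrightarrow> norm (R *v v0) \<le> norm (R *v v)"
    using continuous_attains_inf[OF compact_sphere] by metis
  define c where "c = norm (R *v v0)"
  have n0: "norm v0 = 1" using v0 by simp
  have below: "c * norm v \<le> norm (R *v v)" for v
  proof (cases "v = 0")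
    case False
    then have "c \<le> norm (R *v ((1 / norm v) *\<^sub>R v))"
      unfolding c_def by (intro min) simp
    also have "\<dots> = norm (R *v v) / norm v"
      by (simp add: matrix_vector_mult_scaleR)
    finally show ?thesis using False by (simp add: field_simps)
  qed simp
  \<comment> \<open>\<open>Q\<close> is a nonnegative quadratic form vanishing at \<open>v0\<close>, so its derivative at \<open>v0\<close>, which is
    twice the vector \<open>w\<close> below, must vanish.\<close>
  define Q where "Q v = (norm (R *v v))\<^sup>2 - (c * norm v)\<^sup>2" for v
  have Q: "Q v \<ge> 0" for v
    using power_mono[OF below, of v 2] by (simp add: Q_def c_def)
  define w where "w = R *v (R *v v0) - c\<^sup>2 *\<^sub>R v0"
  have expand: "Q (v0 + t *\<^sub>R w) = 2 * t * (norm w)\<^sup>2 + t\<^sup>2 * Q w" for t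
  proof -
    have ww: "(norm w)\<^sup>2 = (R *v v0) \<bullet> (R *v w) - c\<^sup>2 * (v0 \<bullet> w)"
    proof -
      have "(norm w)\<^sup>2 = w \<bullet> w" by (simp add: dot_square_norm)
      also have "\<dots> = (R *v (R *v v0) - c\<^sup>2 *\<^sub>R v0) \<bullet> w" by (simp add: w_def)
      also have "\<dots> = (R *v v0) \<bullet> (R *v w) - c\<^sup>2 * (v0 \<bullet> w)"
        by (simp add: inner_diff_left dot)
      finally show ?thesis .
    qed
    have Qin: "Q v = (R *v v) \<bullet> (R *v v) - c\<^sup>2 * (v \<bullet> v)" for v
      by (simp add: Q_def power_mult_distrib dot_square_norm)
    have Q0: "(R *v v0) \<bullet> (R *v v0) = c\<^sup>2 * (v0 \<bullet> v0)"
      using n0 by (simp add: c_def dot_square_norm)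
    have sq: "(x + t *\<^sub>R y) \<bullet> (x + t *\<^sub>R y) = x \<bullet> x + 2 * t * (x \<bullet> y) + t\<^sup>2 * (y \<bullet> y)"
      for x y :: "real^'n"
      by (simp add: inner_add_left inner_add_right inner_commute[of y x] power2_eq_square distrib_left)
    have "R *v (v0 + t *\<^sub>R w) = R *v v0 + t *\<^sub>R (R *v w)"
      by (simp add: matrix_vector_right_distrib matrix_vector_mult_scaleR)
    then have "Q (v0 + t *\<^sub>R w) =
        (R *v v0 + t *\<^sub>R (R *v w)) \<bullet> (R *v v0 + t *\<^sub>R (R *v w))
          - c\<^sup>2 * ((v0 + t *\<^sub>R w) \<bullet> (v0 + t *\<^sub>R w))"
      by (simp only: Qin)
    then show ?thesis
      unfolding ww Qin[of w] sq Q0 by argo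
  qed
  have "w = 0"
  proof (rule ccontr)
    assume "w \<noteq> 0"
    then have pos: "(norm w)\<^sup>2 > 0" by simp
    \<comment> \<open>A step small enough for the negative linear term to dominate; the summand 1 only avoids
      division by zero.\<close>
    define t where "t = - (norm w)\<^sup>2 / (Q w + 1)"
    have q1: "Q w + 1 > 0" using Q[of w] by simp
    have "0 \<le> 2 * t * (norm w)\<^sup>2 + t\<^sup>2 * Q w"
      using Q expand by metis
    also have "\<dots> = - (((norm w)\<^sup>2)\<^sup>2 / (Q w + 1)\<^sup>2) * (Q w + 2)"
      using q1 unfolding t_def by (simp add: divide_simps power2_eq_square) (simp add: algebra_simps)
    also have "\<dots> < 0"
      using pos q1 by (intro mult_neg_pos) (auto intro!: divide_pos_pos zero_less_power)
    finally show False by simp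
  qed
  then have RR: "R *v (R *v v0) = c\<^sup>2 *\<^sub>R v0" by (simp add: w_def)
  \<comment> \<open>\<open>R\<^sup>2 - c\<^sup>2 = (R - c) (R + c)\<close> kills \<open>v0\<close>, so either \<open>v0\<close> is an eigenvector for \<open>- c\<close> or
    \<open>R v0 + c v0\<close> is one for \<open>c\<close>.\<close>
  have "c > 1"
  proof (cases "R *v v0 + c *\<^sub>R v0 = 0")
    case True
    then have "R *v v0 = (- c) *\<^sub>R v0" by (simp add: eq_neg_iff_add_eq_0)
    moreover have "v0 \<noteq> 0" using n0 by auto
    ultimately have "\<bar>- c\<bar> > 1" using eig by blast
    then show ?thesis by (simp add: c_def)
  next
    case False
    have "R *v (R *v v0 + c *\<^sub>R v0) = c *\<^sub>R (R *v v0 + c *\<^sub>R v0)"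
      by (simp add: matrix_vector_right_distrib matrix_vector_mult_scaleR RR power2_eq_square algebra_simps)
    from eig[OF False this] show ?thesis by (auto simp: c_def)
  qed
  with below show ?thesis using that by blast
qed

lemma matrix_inv_mult:
  fixes A :: "'a::semiring_1^'n^'m"
  assumes "invertible A"
  shows "A ** matrix_inv A = mat 1" "matrix_inv A ** A = mat 1"
  using someI_ex[OF assms[unfolded invertible_def]] by (simp_all add: matrix_inv_def)

lemma symmetric_expansive_matrix_inv:
  fixes R :: "real^'n^'n"
  assumes "transpose R = R" "expansive R"
  obtains r where "0 \<le> r" "r < 1" "\<And>v. norm (matrix_inv R *v v) \<le> r * norm v" "invertible R"
proof -
  obtain c where c: "c > 1" "\<And>v. c * norm v \<le> norm (R *v v)"
    using symmetric_matrix_bounded_below[OF assms] by blast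
  have "v = 0" if "R *v v = 0" for v
    using c(2)[of v] c(1) that by (simp add: mult_le_0_iff)
  then have inv: "invertible R"
    by (simp add: invertible_left_inverse matrix_left_invertible_ker)
  have "norm (matrix_inv R *v v) \<le> inverse c * norm v" for v
  proof -
    have "R *v (matrix_inv R *v v) = v"
      using inv by (simp add: matrix_vector_mul_assoc matrix_inv_mult)
    then show ?thesis using c(2)[of "matrix_inv R *v v"] c(1) by (simp add: field_simps)
  qed
  moreover have "inverse c < 1" using c(1) by (simp add: field_simps)
  ultimately show ?thesis using that[of "inverse c"] c(1) inv by auto
qed

section \<open>The invariance equation for integrals\<close>

lemma ifs_map_borel [measurable]: "ifs_map M b \<in> borel_measurable borel"
  unfolding ifs_map_def[abs_def]
  by (intro borel_measurable_continuous_onI continuous_intros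
        bounded_linear.continuous_on[OF matrix_vector_mul_bounded_linear])

text \<open>The averaged sum over \<open>B\<close> becomes an integral over a random digit, the form that matches
  product and stream spaces.\<close>

lemma is_invariant_measure_iff_nn_integral:
  assumes fin: "finite B" "B \<noteq> {}" and "prob_space \<mu>" and sets: "sets \<mu> = sets borel"
  shows "is_invariant_measure M B \<mu> \<longleftrightarrow>
    (\<forall>A\<in>sets borel. emeasure \<mu> A = (\<integral>\<^sup>+b. emeasure \<mu> (ifs_map M b -` A) \<partial>uniform_count_measure B))"
proof -
  interpret prob_space \<mu> by fact
  have meas [measurable]: "ifs_map M b \<in> measurable \<mu> borel" for b
    using ifs_map_borel sets by (simp cong: measurable_cong_sets)
  have sp: "space \<mu> = UNIV" using sets_eq_imp_space_eq[OF sets] by simp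
  have "(measure \<mu> A = 1 / real (card B) * (\<Sum>b\<in>B. measure (distr \<mu> borel (ifs_map M b)) A)) \<longleftrightarrow>
     emeasure \<mu> A = (\<integral>\<^sup>+b. emeasure \<mu> (ifs_map M b -` A) \<partial>uniform_count_measure B)"
    if A: "A \<in> sets borel" for A
  proof -
    have "(\<integral>\<^sup>+b. emeasure \<mu> (ifs_map M b -` A) \<partial>uniform_count_measure B) =
        (\<Sum>b\<in>B. ennreal (1 / card B) * ennreal (measure \<mu> (ifs_map M b -` A)))"
      by (simp add: uniform_count_measure_def nn_integral_point_measure_finite fin emeasure_eq_measure)
    also have "\<dots> = (\<Sum>b\<in>B. ennreal (1 / card B * measure \<mu> (ifs_map M b -` A)))"
      by (intro sum.cong refl ennreal_mult[symmetric]) auto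
    also have "\<dots> = ennreal (\<Sum>b\<in>B. 1 / card B * measure \<mu> (ifs_map M b -` A))"
      by (rule sum_ennreal) simp
    also have "\<dots> = ennreal (1 / real (card B) * (\<Sum>b\<in>B. measure (distr \<mu> borel (ifs_map M b)) A))"
      using A by (simp add: sum_distrib_left measure_distr sp)
    finally show ?thesis
      by (simp add: emeasure_eq_measure sum_nonneg)
  qed
  with assms show ?thesis by (auto simp: is_invariant_measure_def)
qed

lemma invariant_integral:
  fixes f :: "real^'n \<Rightarrow> real"
  assumes fin: "finite B" "B \<noteq> {}" and inv: "is_invariant_measure M B \<mu>"
    and f: "f \<in> borel_measurable borel" and bdd: "\<And>x. \<bar>f x\<bar> \<le> K"
  shows "(\<integral>x. f x \<partial>\<mu>) = (\<Sum>b\<in>B. \<integral>x. f (ifs_map M b x) \<partial>\<mu>) / card B"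
proof -
  define U where "U = uniform_count_measure B"
  have "prob_space \<mu>" and sets [measurable_cong]: "sets \<mu> = sets borel"
    using inv by (auto simp: is_invariant_measure_def)
  have sp: "space \<mu> = UNIV" using sets_eq_imp_space_eq[OF sets] by simp
  interpret \<mu>: prob_space \<mu> by fact
  interpret U: prob_space U
    unfolding U_def using fin by (rule prob_space_uniform_count_measure)
  interpret P: pair_prob_space U \<mu> ..
  have meas: "(\<lambda>(b, x). ifs_map M b x) \<in> measurable (U \<Otimes>\<^sub>M \<mu>) borel"
  proof -
    have "(\<lambda>(b, x). ifs_map M b x) \<in> measurable (count_space B \<Otimes>\<^sub>M \<mu>) borel"
      using fin by (intro measurable_pair_measure_countable1) (auto simp: countable_finite)
    moreover have "sets (U \<Otimes>\<^sub>M \<mu>) = sets (count_space B \<Otimes>\<^sub>M \<mu>)"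
      by (intro sets_pair_measure_cong) (auto simp: U_def sets_uniform_count_measure)
    ultimately show ?thesis by (simp cong: measurable_cong_sets)
  qed
  \<comment> \<open>\<open>\<mu>\<close> is the law of \<open>ifs_map M b x\<close> for independent \<open>b\<close> (uniform) and \<open>x\<close> (with law \<open>\<mu>\<close>).\<close>
  have "\<mu> = distr (U \<Otimes>\<^sub>M \<mu>) borel (\<lambda>(b, x). ifs_map M b x)"
  proof (rule measure_eqI)
    fix A assume "A \<in> sets \<mu>"
    then have A: "A \<in> sets borel" by (simp add: sets)
    have "emeasure (distr (U \<Otimes>\<^sub>M \<mu>) borel (\<lambda>(b, x). ifs_map M b x)) A =
       emeasure (U \<Otimes>\<^sub>M \<mu>) ((\<lambda>(b, x). ifs_map M b x) -` A \<inter> space (U \<Otimes>\<^sub>M \<mu>))"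
      by (rule emeasure_distr[OF meas A])
    also have "\<dots> = (\<integral>\<^sup>+b. emeasure \<mu> (Pair b -` ((\<lambda>(b, x). ifs_map M b x) -` A \<inter> space (U \<Otimes>\<^sub>M \<mu>))) \<partial>U)"
      by (rule \<mu>.emeasure_pair_measure_alt[OF measurable_sets[OF meas A]])
    also have "\<dots> = (\<integral>\<^sup>+b. emeasure \<mu> (ifs_map M b -` A) \<partial>U)"
      by (intro nn_integral_cong arg_cong[where f="emeasure \<mu>"]) (auto simp: space_pair_measure sp)
    also have "\<dots> = emeasure \<mu> A"
      using is_invariant_measure_iff_nn_integral[OF fin \<open>prob_space \<mu>\<close> sets] inv A
      by (auto simp: U_def)
    finally show "emeasure \<mu> A = emeasure (distr (U \<Otimes>\<^sub>M \<mu>) borel (\<lambda>(b, x). ifs_map M b x)) A" ..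
  qed (simp add: sets)
  then have "(\<integral>x. f x \<partial>\<mu>) = (\<integral>x. f x \<partial>distr (U \<Otimes>\<^sub>M \<mu>) borel (\<lambda>(b, x). ifs_map M b x))"
    by simp
  also have "\<dots> = (\<integral>z. f (case z of (b, x) \<Rightarrow> ifs_map M b x) \<partial>(U \<Otimes>\<^sub>M \<mu>))"
    by (rule integral_distr[OF meas f])
  also have "\<dots> = (\<integral>b. \<integral>x. f (ifs_map M b x) \<partial>\<mu> \<partial>U)"
  proof -
    have "integrable (U \<Otimes>\<^sub>M \<mu>) (\<lambda>z. f (case z of (b, x) \<Rightarrow> ifs_map M b x))"
      using bdd by (intro P.integrable_const_bound[where B=K] measurable_compose[OF meas f]) auto
    from P.integral_fst'[OF this] show ?thesis by simp
  qed
  also have "\<dots> = (\<Sum>b\<in>B. \<integral>x. f (ifs_map M b x) \<partial>\<mu>) / card B"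
    unfolding U_def by (rule integral_uniform_count_measure[OF fin(1)])
  finally show ?thesis .
qed

text \<open>If \<open>\<phi>\<close> controls the increments of \<open>f\<close>, then \<open>\<phi> \<circ> M\<^sup>-\<^sup>1\<close> controls those of
  \<open>f \<circ> ifs_map M b\<close>, whatever the digit \<open>b\<close>. This is why the induction on \<open>n\<close> generalises over both
  \<open>f\<close> and \<open>\<phi>\<close>.\<close>

lemma invariant_integral_diff_le:
  fixes f \<phi> :: "real^'n \<Rightarrow> real"
  assumes fin: "finite B" "B \<noteq> {}"
    and \<mu>: "is_invariant_measure M B \<mu>" and \<nu>: "is_invariant_measure M B \<nu>"
    and "f \<in> borel_measurable borel" and "\<And>x. \<bar>f x\<bar> \<le> 1"
    and "continuous_on UNIV \<phi>" and "\<And>x. \<bar>\<phi> x\<bar> \<le> 1"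
    and "\<And>x y. \<bar>f x - f y\<bar> \<le> \<phi> (x - y)"
  shows "\<bar>(\<integral>x. f x \<partial>\<mu>) - (\<integral>x. f x \<partial>\<nu>)\<bar> \<le>
    (\<integral>z. \<phi> (((*v) (matrix_inv M) ^^ n) (fst z - snd z)) \<partial>(\<mu> \<Otimes>\<^sub>M \<nu>))"
  using assms(5-)
proof (induction n arbitrary: f \<phi>)
  case 0
  note [measurable] = 0(1) borel_measurable_continuous_onI[OF 0(3)]
  have "prob_space \<mu>" and sets [measurable_cong]: "sets \<mu> = sets borel"
    using \<mu> by (auto simp: is_invariant_measure_def)
  have "prob_space \<nu>" and sets' [measurable_cong]: "sets \<nu> = sets borel"
    using \<nu> by (auto simp: is_invariant_measure_def)
  interpret \<mu>: prob_space \<mu> by fact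
  interpret \<nu>: prob_space \<nu> by fact
  interpret P: pair_prob_space \<mu> \<nu> ..
  have i1: "integrable (\<mu> \<Otimes>\<^sub>M \<nu>) (\<lambda>z. f (fst z))"
    using 0(2) by (intro P.integrable_const_bound[where B=1]) auto
  have i2: "integrable (\<mu> \<Otimes>\<^sub>M \<nu>) (\<lambda>z. f (snd z))"
    using 0(2) by (intro P.integrable_const_bound[where B=1]) auto
  have i3: "integrable (\<mu> \<Otimes>\<^sub>M \<nu>) (\<lambda>z. \<phi> (fst z - snd z))"
    using 0(4) by (intro P.integrable_const_bound[where B=1]) auto
  have e1: "(\<integral>z. f (fst z) \<partial>(\<mu> \<Otimes>\<^sub>M \<nu>)) = (\<integral>x. f x \<partial>\<mu>)"
    using P.integral_fst'[OF i1] by (simp add: \<nu>.prob_space)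
  have e2: "(\<integral>z. f (snd z) \<partial>(\<mu> \<Otimes>\<^sub>M \<nu>)) = (\<integral>x. f x \<partial>\<nu>)"
    using P.integral_fst'[OF i2] by (simp add: \<mu>.prob_space)
  have "\<bar>(\<integral>x. f x \<partial>\<mu>) - (\<integral>x. f x \<partial>\<nu>)\<bar> = \<bar>\<integral>z. f (fst z) - f (snd z) \<partial>(\<mu> \<Otimes>\<^sub>M \<nu>)\<bar>"
    using i1 i2 by (simp add: e1 e2)
  also have "\<dots> \<le> (\<integral>z. \<bar>f (fst z) - f (snd z)\<bar> \<partial>(\<mu> \<Otimes>\<^sub>M \<nu>))"
    by (rule integral_abs_bound)
  also have "\<dots> \<le> (\<integral>z. \<phi> (fst z - snd z) \<partial>(\<mu> \<Otimes>\<^sub>M \<nu>))"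
    using i1 i2 i3 0(5) by (intro integral_mono integrable_abs) auto
  finally show ?case by simp
next
  case (Suc n)
  let ?I = "\<integral>z. \<phi> (((*v) (matrix_inv M) ^^ Suc n) (fst z - snd z)) \<partial>(\<mu> \<Otimes>\<^sub>M \<nu>)"
  note [measurable] = Suc.prems(1)
  have step: "\<bar>(\<integral>x. f (ifs_map M b x) \<partial>\<mu>) - (\<integral>x. f (ifs_map M b x) \<partial>\<nu>)\<bar> \<le> ?I" for b
  proof -
    have "\<bar>(\<integral>x. f (ifs_map M b x) \<partial>\<mu>) - (\<integral>x. f (ifs_map M b x) \<partial>\<nu>)\<bar> \<le>
      (\<integral>z. \<phi> (matrix_inv M *v (((*v) (matrix_inv M) ^^ n) (fst z - snd z))) \<partial>(\<mu> \<Otimes>\<^sub>M \<nu>))"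
    proof (rule Suc.IH)
      show "continuous_on UNIV (\<lambda>x. \<phi> (matrix_inv M *v x))"
        by (rule continuous_on_compose2[OF Suc.prems(3)]) (auto intro: continuous_intros)
      fix x y
      have "ifs_map M b x - ifs_map M b y = matrix_inv M *v (x - y)"
        by (simp add: ifs_map_def matrix_vector_right_distrib matrix_vector_mult_diff_distrib)
      then show "\<bar>f (ifs_map M b x) - f (ifs_map M b y)\<bar> \<le> \<phi> (matrix_inv M *v (x - y))"
        using Suc.prems(5)[of "ifs_map M b x" "ifs_map M b y"] by simp
    qed (use Suc.prems in auto)
    then show ?thesis by simp
  qed
  have c: "card B > 0" using fin by (simp add: card_gt_0_iff)
  have "\<bar>(\<integral>x. f x \<partial>\<mu>) - (\<integral>x. f x \<partial>\<nu>)\<bar> =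
      \<bar>(\<Sum>b\<in>B. (\<integral>x. f (ifs_map M b x) \<partial>\<mu>) - (\<integral>x. f (ifs_map M b x) \<partial>\<nu>)) / card B\<bar>"
    unfolding invariant_integral[OF fin \<mu> Suc.prems(1,2)] invariant_integral[OF fin \<nu> Suc.prems(1,2)]
    by (simp add: sum_subtractf diff_divide_distrib)
  also have "\<dots> \<le> (\<Sum>b\<in>B. \<bar>(\<integral>x. f (ifs_map M b x) \<partial>\<mu>) - (\<integral>x. f (ifs_map M b x) \<partial>\<nu>)\<bar>) / card B"
    using c by (simp add: divide_right_mono)
  also have "\<dots> \<le> (\<Sum>b\<in>B. ?I) / card B"
    by (intro divide_right_mono sum_mono step) simp
  also have "\<dots> = ?I" using c by simp
  finally show ?case .
qed

section \<open>Existence and uniqueness of the invariant measure\<close>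

lemma norm_funpow_contraction:
  fixes A :: "real^'n^'n"
  assumes "0 \<le> r" "\<And>v. norm (A *v v) \<le> r * norm v"
  shows "norm (((*v) A ^^ n) v) \<le> r ^ n * norm v"
proof (induction n)
  case (Suc n)
  have "norm (((*v) A ^^ Suc n) v) \<le> r * norm (((*v) A ^^ n) v)"
    using assms(2) by simp
  also have "\<dots> \<le> r * (r ^ n * norm v)"
    using assms(1) Suc by (intro mult_left_mono)
  finally show ?case by (simp add: mult.assoc)
qed simp

lemma continuous_on_funpow_matrix:
  fixes A :: "real^'n^'n"
  shows "continuous_on UNIV ((*v) A ^^ n)"
proof (induction n)
  case (Suc n)
  show ?case
    unfolding funpow.simps by (intro continuous_on_compose continuous_intros Suc)
qed simp

lemma funpow_tendsto_0:
  fixes A :: "real^'n^'n"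
  assumes "0 \<le> r" "r < 1" "\<And>v. norm (A *v v) \<le> r * norm v"
  shows "(\<lambda>n. ((*v) A ^^ n) v) \<longlonglongrightarrow> 0"
proof (rule Lim_null_comparison)
  show "\<forall>\<^sub>F n in sequentially. norm (((*v) A ^^ n) v) \<le> r ^ n * norm v"
    using norm_funpow_contraction[OF assms(1,3)] by auto
  show "(\<lambda>n. r ^ n * norm v) \<longlonglongrightarrow> 0"
    using assms by (intro tendsto_mult_left_zero LIMSEQ_realpow_zero)
qed

lemma invariant_integral_unique:
  fixes f :: "real^'n \<Rightarrow> real"
  assumes fin: "finite B" "B \<noteq> {}"
    and \<mu>: "is_invariant_measure M B \<mu>" and \<nu>: "is_invariant_measure M B \<nu>"
    and r: "0 \<le> r" "r < 1" "\<And>v. norm (matrix_inv M *v v) \<le> r * norm v"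
    and f: "f \<in> borel_measurable borel" "\<And>x. 0 \<le> f x" "\<And>x. f x \<le> 1"
    and lip: "\<And>x y. \<bar>f x - f y\<bar> \<le> K * dist x y" and K: "0 \<le> K"
  shows "(\<integral>x. f x \<partial>\<mu>) = (\<integral>x. f x \<partial>\<nu>)"
proof -
  define \<phi> where "\<phi> v = min 1 (K * norm v)" for v :: "real^'n"
  have \<phi>: "continuous_on UNIV \<phi>" "\<And>x. \<bar>\<phi> x\<bar> \<le> 1" "\<phi> 0 = 0"
    using K by (auto simp: \<phi>_def[abs_def] intro!: continuous_intros)
  have bound: "\<bar>f x - f y\<bar> \<le> \<phi> (x - y)" for x y
    using lip[of x y] f(2,3)[of x] f(2,3)[of y] by (auto simp: \<phi>_def dist_norm)
  have "prob_space \<mu>" and sets [measurable_cong]: "sets \<mu> = sets borel"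
    using \<mu> by (auto simp: is_invariant_measure_def)
  have "prob_space \<nu>" and sets' [measurable_cong]: "sets \<nu> = sets borel"
    using \<nu> by (auto simp: is_invariant_measure_def)
  interpret \<mu>: prob_space \<mu> by fact
  interpret \<nu>: prob_space \<nu> by fact
  interpret P: pair_prob_space \<mu> \<nu> ..
  let ?I = "\<lambda>n. \<integral>z. \<phi> (((*v) (matrix_inv M) ^^ n) (fst z - snd z)) \<partial>(\<mu> \<Otimes>\<^sub>M \<nu>)"
  note [measurable] = borel_measurable_continuous_onI[OF \<phi>(1)]
    borel_measurable_continuous_onI[OF continuous_on_funpow_matrix]
  have "?I \<longlonglongrightarrow> (\<integral>z. 0 \<partial>(\<mu> \<Otimes>\<^sub>M \<nu>))"
  proof (rule integral_dominated_convergence[where w="\<lambda>_. 1"])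
    show "AE z in \<mu> \<Otimes>\<^sub>M \<nu>. (\<lambda>n. \<phi> (((*v) (matrix_inv M) ^^ n) (fst z - snd z))) \<longlonglongrightarrow> 0"
    proof (rule AE_I2)
      fix z :: "(real^'n) \<times> (real^'n)"
      have "isCont \<phi> 0" using \<phi>(1) by (simp add: continuous_on_eq_continuous_at)
      from isCont_tendsto_compose[OF this funpow_tendsto_0[OF r]]
      show "(\<lambda>n. \<phi> (((*v) (matrix_inv M) ^^ n) (fst z - snd z))) \<longlonglongrightarrow> 0"
        by (simp add: \<phi>(3))
    qed
  qed (use \<phi>(2) in auto)
  moreover have "\<bar>(\<integral>x. f x \<partial>\<mu>) - (\<integral>x. f x \<partial>\<nu>)\<bar> \<le> ?I n" for n
    using f by (intro invariant_integral_diff_le[OF fin \<mu> \<nu> _ _ \<phi>(1,2) bound])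
      (auto simp: abs_le_iff intro: order_trans)
  ultimately have "\<bar>(\<integral>x. f x \<partial>\<mu>) - (\<integral>x. f x \<partial>\<nu>)\<bar> \<le> 0"
    by (intro LIMSEQ_le_const[where X="?I"]) auto
  then show ?thesis by simp
qed

text \<open>The indicator of a nonempty closed set \<open>C\<close> is the decreasing limit of the Lipschitz
  functions \<open>max 0 (1 - k \<cdot> infdist x C)\<close>, and the closed sets form an intersection-stable generator
  of the Borel sets.\<close>

lemma borel_prob_eqI_Lipschitz:
  fixes \<mu> \<nu> :: "'a::metric_space measure"
  assumes "prob_space \<mu>" "prob_space \<nu>" and sets: "sets \<mu> = sets borel" "sets \<nu> = sets borel"
    and eq: "\<And>f K. f \<in> borel_measurable borel \<Longrightarrow> (\<And>x. 0 \<le> f x) \<Longrightarrow> (\<And>x. f x \<le> 1) \<Longrightarrow>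
       (\<And>x y. \<bar>f x - f y\<bar> \<le> K * dist x y) \<Longrightarrow> 0 \<le> K \<Longrightarrow> (\<integral>x. f x \<partial>\<mu>) = (\<integral>x. f x \<partial>\<nu>)"
  shows "\<mu> = \<nu>"
proof -
  interpret \<mu>: prob_space \<mu> by fact
  interpret \<nu>: prob_space \<nu> by fact
  note [measurable_cong] = sets
  have sp: "space \<mu> = UNIV" "space \<nu> = UNIV"
    using sets[THEN sets_eq_imp_space_eq] by auto
  have closed: "emeasure \<mu> C = emeasure \<nu> C" if C: "closed C" for C
  proof (cases "C = {}")
    case False
    define f where "f k x = max 0 (1 - real k * infdist x C)" for k and x :: 'a
    have meas: "f k \<in> borel_measurable borel" for k
      unfolding f_def[abs_def] by (intro borel_measurable_continuous_onI continuous_intros)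
    have lim: "(\<lambda>k. f k x) \<longlonglongrightarrow> indicat_real C x" for x
    proof (cases "x \<in> C")
      case True
      then show ?thesis by (simp add: f_def)
    next
      case False
      then have pos: "infdist x C > 0"
        using C \<open>C \<noteq> {}\<close> by (simp add: infdist_pos_not_in_closed)
      obtain k0 :: nat where k0: "1 / infdist x C < real k0" using reals_Archimedean2 by blast
      have "f k x = 0" if "k \<ge> k0" for k
      proof -
        have "1 / infdist x C < real k" using k0 that by (meson less_le_trans of_nat_le_iff)
        with pos show ?thesis by (simp add: f_def field_simps)
      qed
      then have "\<forall>\<^sub>F k in sequentially. f k x = 0" by (auto simp: eventually_sequentially)
      then show ?thesis using False by (simp add: tendsto_eventually)
    qed
    have conv: "(\<lambda>k. \<integral>x. f k x \<partial>\<rho>) \<longlonglongrightarrow> measure \<rho> C"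
      if "prob_space \<rho>" and s [measurable_cong]: "sets \<rho> = sets borel" for \<rho>
    proof -
      interpret \<rho>: prob_space \<rho> by fact
      have meas\<rho>: "f k \<in> borel_measurable \<rho>" for k
        using meas s by (simp cong: measurable_cong_sets)
      have [measurable]: "C \<in> sets borel" using C by simp
      have "(\<lambda>k. \<integral>x. f k x \<partial>\<rho>) \<longlonglongrightarrow> (\<integral>x. indicat_real C x \<partial>\<rho>)"
      proof (rule integral_dominated_convergence[where w="\<lambda>_. 1"])
        show "AE x in \<rho>. norm (f k x) \<le> 1" for k by (auto simp: f_def infdist_nonneg)
      qed (use lim meas\<rho> in auto)
      then show ?thesis using sets_eq_imp_space_eq[OF s] by simp
    qed
    have "(\<integral>x. f k x \<partial>\<mu>) = (\<integral>x. f k x \<partial>\<nu>)" for k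
    proof (rule eq[OF meas])
      fix x y
      have "\<bar>f k x - f k y\<bar> \<le> \<bar>real k * infdist x C - real k * infdist y C\<bar>"
        by (auto simp: f_def)
      also have "\<dots> = real k * \<bar>infdist x C - infdist y C\<bar>"
        by (simp add: abs_mult flip: right_diff_distrib)
      also have "\<dots> \<le> real k * dist x y"
        by (intro mult_left_mono infdist_triangle_abs) simp
      finally show "\<bar>f k x - f k y\<bar> \<le> real k * dist x y" .
    qed (auto simp: f_def infdist_nonneg)
    then have "measure \<mu> C = measure \<nu> C"
      using conv[OF assms(1) sets(1)] conv[OF assms(2) sets(2)] LIMSEQ_unique by simp
    then show ?thesis by (simp add: \<mu>.emeasure_eq_measure \<nu>.emeasure_eq_measure)
  qed simp
  have gen: "sets borel = sigma_sets UNIV (Collect closed :: 'a set set)"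
    by (simp add: borel_eq_closed)
  show ?thesis
    by (rule measure_eqI_generator_eq[where E="Collect closed" and \<Omega>=UNIV and A="\<lambda>_. UNIV"])
       (auto simp: sets gen closed Int_stable_def)
qed

lemma ex1_invariant_measure:
  fixes M :: "real^'n^'n"
  assumes fin: "finite B" "B \<noteq> {}"
    and r: "0 \<le> r" "r < 1" "\<And>v. norm (matrix_inv M *v v) \<le> r * norm v"
  shows "\<exists>!\<mu>. is_invariant_measure M B \<mu>"
proof (rule ex_ex1I)
  define U where "U = uniform_count_measure B"
  define A where "A = matrix_inv M"
  define S where "S \<omega> = (\<Sum>k. ((*v) A ^^ Suc k) (\<omega> !! k))" for \<omega>
  interpret U: prob_space U
    unfolding U_def using fin by (rule prob_space_uniform_count_measure)
  interpret SU: prob_space "stream_space U" by (rule U.prob_space_stream_space)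
  have spU: "space U = B" by (simp add: U_def space_uniform_count_measure)
  have measS [measurable]: "S \<in> borel_measurable (stream_space U)"
    unfolding S_def[abs_def]
  proof (rule borel_measurable_suminf)
    fix k
    have "((*v) A ^^ Suc k) \<in> borel_measurable U"
      by (simp add: U_def uniform_count_measure_def)
    then show "(\<lambda>\<omega>. ((*v) A ^^ Suc k) (\<omega> !! k)) \<in> borel_measurable (stream_space U)"
      by (rule measurable_compose[OF measurable_snth])
  qed
  \<comment> \<open>The digits are bounded, so the series is dominated by a geometric one.\<close>
  obtain D where D: "\<And>b. b \<in> B \<Longrightarrow> norm b \<le> D"
    using finite_imp_bounded[OF fin(1)] by (auto simp: bounded_iff)
  have summ: "summable (\<lambda>k. ((*v) A ^^ k) (\<omega> !! k))" if "\<omega> \<in> streams B" for \<omega>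
  proof (rule summable_comparison_test')
    show "summable (\<lambda>k. r ^ k * D)" using r by (intro summable_mult2 summable_geometric) simp
    show "norm (((*v) A ^^ k) (\<omega> !! k)) \<le> r ^ k * D" if "k \<ge> 0" for k
    proof -
      have "norm (((*v) A ^^ k) (\<omega> !! k)) \<le> r ^ k * norm (\<omega> !! k)"
        using r by (intro norm_funpow_contraction) (auto simp: A_def)
      also have "\<dots> \<le> r ^ k * D"
        using \<open>\<omega> \<in> streams B\<close> r(1) by (intro mult_left_mono D) (auto simp: streams_iff_snth)
      finally show ?thesis .
    qed
  qed
  have S_eq: "S \<omega> = A *v (\<Sum>k. ((*v) A ^^ k) (\<omega> !! k))" if "\<omega> \<in> streams B" for \<omega>
    unfolding S_def
    by (simp add: bounded_linear.suminf[OF matrix_vector_mul_bounded_linear summ[OF that]])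
  have S_Cons: "S (b ## \<omega>) = ifs_map M b (S \<omega>)" if "b \<in> B" "\<omega> \<in> streams B" for b \<omega>
  proof -
    have "b ## \<omega> \<in> streams B" using that by (simp add: streams_Stream)
    note S_eq[OF this] suminf_split_head[OF summ[OF this]]
    then show ?thesis by (simp add: ifs_map_def A_def[symmetric] S_def add.commute)
  qed
  show "\<exists>\<mu>. is_invariant_measure M B \<mu>"
  proof
    let ?\<mu> = "distr (stream_space U) borel S"
    show "is_invariant_measure M B ?\<mu>"
    proof (subst is_invariant_measure_iff_nn_integral[OF fin])
      show "prob_space ?\<mu>" by (rule SU.prob_space_distr) simp
      show "\<forall>C\<in>sets borel. emeasure ?\<mu> C =
          (\<integral>\<^sup>+b. emeasure ?\<mu> (ifs_map M b -` C) \<partial>uniform_count_measure B)"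
      proof
        fix C :: "(real^'n) set" assume C [measurable]: "C \<in> sets borel"
        let ?X = "S -` C \<inter> space (stream_space U)"
        have "emeasure ?\<mu> C = emeasure (stream_space U) ?X"
          by (simp add: emeasure_distr)
        also have "\<dots> = (\<integral>\<^sup>+b. emeasure (stream_space U) {\<omega>\<in>space (stream_space U). b ## \<omega> \<in> ?X} \<partial>U)"
          by (rule U.emeasure_stream_space) simp
        also have "\<dots> = (\<integral>\<^sup>+b. emeasure ?\<mu> (ifs_map M b -` C) \<partial>U)"
        proof (rule nn_integral_cong)
          fix b assume b: "b \<in> space U"
          have "ifs_map M b -` C \<in> sets borel"
            using measurable_sets[OF ifs_map_borel C] by simp
          moreover have "{\<omega>\<in>space (stream_space U). b ## \<omega> \<in> ?X} =
              S -` (ifs_map M b -` C) \<inter> space (stream_space U)"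
            using b by (auto simp: space_stream_space spU S_Cons streams_Stream)
          ultimately show "emeasure (stream_space U) {\<omega>\<in>space (stream_space U). b ## \<omega> \<in> ?X} =
              emeasure ?\<mu> (ifs_map M b -` C)"
            by (simp add: emeasure_distr)
        qed
        finally show "emeasure ?\<mu> C = (\<integral>\<^sup>+b. emeasure ?\<mu> (ifs_map M b -` C) \<partial>uniform_count_measure B)"
          by (simp add: U_def)
      qed
    qed simp
  qed
next
  fix \<mu> \<nu> assume \<mu>: "is_invariant_measure M B \<mu>" and \<nu>: "is_invariant_measure M B \<nu>"
  show "\<mu> = \<nu>"
  proof (rule borel_prob_eqI_Lipschitz)
    fix f :: "real^'n \<Rightarrow> real" and K :: real
    assume "f \<in> borel_measurable borel" "\<And>x. 0 \<le> f x" "\<And>x. f x \<le> 1"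
      "\<And>x y. \<bar>f x - f y\<bar> \<le> K * dist x y" "0 \<le> K"
    then show "(\<integral>x. f x \<partial>\<mu>) = (\<integral>x. f x \<partial>\<nu>)"
      by (rule invariant_integral_unique[OF fin \<mu> \<nu> r])
  qed (use \<mu> \<nu> in \<open>auto simp: is_invariant_measure_def\<close>)
qed

section \<open>Transport by a commuting matrix\<close>

lemma is_invariant_measure_distr:
  fixes R G :: "real^'n^'n"
  assumes inv: "is_invariant_measure R B \<mu>"
    and comm: "G ** matrix_inv R = matrix_inv R ** G" and inj: "inj ((*v) G)"
  shows "is_invariant_measure R ((*v) G ` B) (distr \<mu> borel ((*v) G))"
proof -
  have "prob_space \<mu>" and sets [measurable_cong]: "sets \<mu> = sets borel"
    using inv by (auto simp: is_invariant_measure_def)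
  interpret prob_space \<mu> by fact
  have Gb [measurable]: "(*v) G \<in> borel_measurable borel"
    by (intro borel_measurable_continuous_onI continuous_intros)
  have injB: "inj_on ((*v) G) B" using inj by (rule inj_on_subset) simp
  have conj: "G *v ifs_map R b x = ifs_map R (G *v b) (G *v x)" for b x
    by (simp add: ifs_map_def matrix_vector_mul_assoc comm flip: matrix_vector_right_distrib)
  have sp: "space \<mu> = UNIV" using sets_eq_imp_space_eq[OF sets] by simp
  have "measure (distr \<mu> borel ((*v) G)) A =
      1 / real (card ((*v) G ` B)) *
        (\<Sum>l\<in>(*v) G ` B. measure (distr (distr \<mu> borel ((*v) G)) borel (ifs_map R l)) A)"
    if A [measurable]: "A \<in> sets borel" for A
  proof -
    have GA: "(*v) G -` A \<in> sets borel"
      using measurable_sets[OF Gb A] by simp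
    have "measure (distr \<mu> borel ((*v) G)) A = measure \<mu> ((*v) G -` A)"
      by (simp add: measure_distr sp)
    also have "\<dots> = 1 / real (card B) * (\<Sum>b\<in>B. measure (distr \<mu> borel (ifs_map R b)) ((*v) G -` A))"
      using inv GA by (auto simp: is_invariant_measure_def)
    also have "(\<Sum>b\<in>B. measure (distr \<mu> borel (ifs_map R b)) ((*v) G -` A)) =
        (\<Sum>b\<in>B. measure (distr (distr \<mu> borel ((*v) G)) borel (ifs_map R (G *v b))) A)"
    proof (rule sum.cong[OF refl])
      fix b
      have "measure (distr \<mu> borel (ifs_map R b)) ((*v) G -` A) = measure \<mu> {x. G *v ifs_map R b x \<in> A}"
        using GA by (simp add: measure_distr sp vimage_def)
      also have "\<dots> = measure (distr (distr \<mu> borel ((*v) G)) borel (ifs_map R (G *v b))) A"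
        by (simp add: distr_distr measure_distr sp conj vimage_def)
      finally show "measure (distr \<mu> borel (ifs_map R b)) ((*v) G -` A) =
         measure (distr (distr \<mu> borel ((*v) G)) borel (ifs_map R (G *v b))) A" .
    qed
    finally show ?thesis
      by (simp add: card_image[OF injB] sum.reindex[OF injB])
  qed
  then show ?thesis
    by (auto simp: is_invariant_measure_def intro: prob_space_distr)
qed

lemma digit_set_image:
  fixes R G :: "real^'n^'n"
  assumes "G ** R = R ** G"
  shows "(*v) G ` digit_set R B = digit_set R ((*v) G ` B)"
proof -
  have pow: "G *v (((*v) R ^^ k) x) = ((*v) R ^^ k) (G *v x)" for k x
  proof (induction k)
    case (Suc k)
    have "G *v (((*v) R ^^ Suc k) x) = R *v (G *v (((*v) R ^^ k) x))"
      by (simp add: matrix_vector_mul_assoc assms)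
    then show ?case by (simp add: Suc)
  qed simp
  have sum: "G *v (\<Sum>k=0..n. ((*v) R ^^ k) (b k)) = (\<Sum>k=0..n. ((*v) R ^^ k) (G *v b k))" for n b
    by (simp add: linear_sum[OF matrix_vector_mul_linear] pow)
  show ?thesis
  proof (intro equalityI subsetI)
    fix y assume "y \<in> (*v) G ` digit_set R B"
    then obtain n b where b: "\<forall>k\<le>n. b k \<in> B" and y: "y = (\<Sum>k=0..n. ((*v) R ^^ k) (G *v b k))"
      by (auto simp: digit_set_def sum)
    then show "y \<in> digit_set R ((*v) G ` B)"
      unfolding digit_set_def by (intro CollectI exI[of _ n] exI[of _ "\<lambda>k. G *v b k"]) auto
  next
    fix y assume "y \<in> digit_set R ((*v) G ` B)"
    then obtain n l where l: "\<forall>k\<le>n. l k \<in> (*v) G ` B" and y: "y = (\<Sum>k=0..n. ((*v) R ^^ k) (l k))"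
      by (auto simp: digit_set_def)
    from l have "\<forall>k. \<exists>b. k \<le> n \<longrightarrow> b \<in> B \<and> l k = G *v b" by blast
    then obtain b where b: "\<And>k. k \<le> n \<Longrightarrow> b k \<in> B \<and> l k = G *v b k" by metis
    then have "y = G *v (\<Sum>k=0..n. ((*v) R ^^ k) (b k))"
      unfolding sum y by (intro sum.cong) auto
    moreover have "(\<Sum>k=0..n. ((*v) R ^^ k) (b k)) \<in> digit_set R B"
      unfolding digit_set_def using b by blast
    ultimately show "y \<in> (*v) G ` digit_set R B" by blast
  qed
qed

lemma fourier_transform_distr_matrix:
  fixes G :: "real^'n^'n"
  assumes "sets \<mu> = sets borel"
  shows "fourier_transform (distr \<mu> borel ((*v) G)) t = fourier_transform \<mu> (transpose G *v t)"
proof -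
  note [measurable_cong] = assms
  have [measurable]: "(*v) G \<in> borel_measurable borel"
    by (intro borel_measurable_continuous_onI continuous_intros)
  have "t \<bullet> (G *v x) = (transpose G *v t) \<bullet> x" for x
    by (simp add: dot_lmul_matrix)
  then show ?thesis
    unfolding fourier_transform_def by (subst integral_distr) (simp_all)
qed

section \<open>The identity of spectral functions\<close>

theorem theorem2p10:
  fixes R G :: "real^'n^'n" and B L :: "(real^'n) set"
  assumes "hadamard_system R B L"
    and "transpose R = R"
    and "invertible G"
    and "transpose G = G"
    and "G ** R = R ** G"
    and "(*v) G ` B = L"
  shows "(*v) G ` digit_set R B = digit_set (transpose R) L \<and>
    (\<forall>t::real^'n.
       spectral_function (invariant_measure (transpose R) L) (digit_set R B) t =
       spectral_function (invariant_measure R B) (digit_set (transpose R) L) (G *v t))"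
proof -
  have fin: "finite B" "B \<noteq> {}" and "expansive R"
    using assms(1) by (auto simp: hadamard_system_def)
  then obtain r where r: "0 \<le> r" "r < 1" "\<And>v. norm (matrix_inv R *v v) \<le> r * norm v"
    and "invertible R"
    using symmetric_expansive_matrix_inv[OF assms(2)] by blast
  then have RI: "R ** matrix_inv R = mat 1" "matrix_inv R ** R = mat 1"
    by (simp_all add: matrix_inv_mult)
  have comm: "G ** matrix_inv R = matrix_inv R ** G"
    by (metis RI assms(5) matrix_mul_assoc matrix_mul_lid matrix_mul_rid)
  have inj: "inj ((*v) G)"
    using assms(3) by (simp add: invertible_left_inverse matrix_left_invertible_injective)
  have finL: "finite L" "L \<noteq> {}" using fin assms(6) by auto
  have digits: "(*v) G ` digit_set R B = digit_set R L"
    using digit_set_image[OF assms(5)] assms(6) by simp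
  define \<mu> where "\<mu> = invariant_measure R B"
  have \<mu>: "is_invariant_measure R B \<mu>"
    unfolding \<mu>_def invariant_measure_def by (rule theI'[OF ex1_invariant_measure[OF fin r]])
  then have sets: "sets \<mu> = sets borel" by (simp add: is_invariant_measure_def)
  have "is_invariant_measure R L (distr \<mu> borel ((*v) G))"
    using is_invariant_measure_distr[OF \<mu> comm inj] assms(6) by simp
  then have L: "invariant_measure R L = distr \<mu> borel ((*v) G)"
    unfolding invariant_measure_def by (rule the1_equality[OF ex1_invariant_measure[OF finL r]])
  have "spectral_function (invariant_measure R L) (digit_set R B) t =
      spectral_function \<mu> (digit_set R L) (G *v t)" for t
    unfolding spectral_function_def digits[symmetric] L
    by (subst infsum_reindex[OF inj_on_subset[OF inj]])
       (simp_all add: o_def fourier_transform_distr_matrix[OF sets] assms(4) matrix_vector_right_distrib)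
  then show ?thesis
    using digits by (simp add: assms(2) \<mu>_def)
qed

end
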